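(* Let $M$ be a pointed metric space, let $\{Y_i\}_{i\in I}$ be a family of Banach spaces, and let $Y=\left[\bigoplus_{i\in I}Y_i\right]_{c_0}$ or $Y=\left[\bigoplus_{i\in I}Y_i\right]_{\ell_\infty}$. If $\overline{\mathrm{LipSNA}(M,Y_i)}=\mathrm{Lip}_0(M,Y_i)$ for every $i\in I$, then $$\overline{\mathrm{LipSNA}(M,Y)}=\mathrm{Lip}_0(M,Y).$$
   Context: All metric spaces are complete and all Banach spaces are real. The index set $I$ is nonempty. A pointed metric space is a metric space $(M,d)$ with a distinguished point $0\in M$. $\mathrm{Lip}_0(M,Y)$ is the Banach space of Lipschitz maps $F\colon M\to Y$ with $F(0)=0$, with norm $\|F\|_L=\sup\{\|F(p)-F(q)\|/d(p,q)\colon p\neq q\}$. $F$ strongly attains its norm if there are $p\neq q$ in $M$ with $\|F(p)-F(q)\|/d(p,q)=\|F\|_L$; $\mathrm{LipSNA}(M,Y)$ is the set of such maps. Closures are with respect to $\|\cdot\|_L$. $\left[\bigoplus_{i\in I}Y_i\right]_{\ell_\infty}$ is the space of bounded families $(y_i)_{i\in I}$, $y_i\in Y_i$, with norm $\sup_i\|y_i\|$; $\left[\bigoplus_{i\in I}Y_i\right]_{c_0}$ is its closed subspace of families such that $\{i\in I\colon\|y_i\|>\delta\}$ is finite for every $\delta>0$. *)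

theory Defs
  imports "HOL-Analysis.Analysis" "HOL-Algebra.Module"
begin

section \<open>Real Banach spaces with explicit carriers\<close>

text \<open>
  The members of a family of Banach spaces cannot have types depending on the index, so normed
  spaces are modules over the field of real numbers, in the sense of HOL-Algebra, together with
  a norm. The ring fields \<open>mult\<close> and \<open>one\<close> that a module record inherits carry no meaning.
\<close>

definition real_ring :: "real ring"
  where "real_ring = \<lparr>carrier = UNIV, mult = (*), one = 1, zero = 0, add = (+)\<rparr>"

record 'b normed = "(real, 'b) module" +
  vnorm :: "'b \<Rightarrow> real"

text \<open>
  The locale \<^locale>\<open>Metric_space\<close> demands nonnegativity and symmetry of the distance on the whole
  type, hence the value \<open>0\<close> outside the carrier.
\<close>

definition norm_metric :: "('b, 'e) normed_scheme \<Rightarrow> 'b metric"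
  where "norm_metric V = metric (carrier V,
    \<lambda>x y. if x \<in> carrier V \<and> y \<in> carrier V then vnorm V (x \<ominus>\<^bsub>V\<^esub> y) else 0)"

locale real_normed_space = module real_ring V for V (structure) +
  assumes vnorm_eq_0_iff: "x \<in> carrier V \<Longrightarrow> vnorm V x = 0 \<longleftrightarrow> x = \<zero>"
    and vnorm_triangle:
      "\<lbrakk>x \<in> carrier V; y \<in> carrier V\<rbrakk> \<Longrightarrow> vnorm V (x \<oplus> y) \<le> vnorm V x + vnorm V y"
    and vnorm_smult: "x \<in> carrier V \<Longrightarrow> vnorm V (a \<odot>\<^bsub>V\<^esub> x) = \<bar>a\<bar> * vnorm V x"

locale real_banach_space = real_normed_space +
  assumes complete: "mcomplete_of (norm_metric V)"

section \<open>Sums of families of normed spaces\<close>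

definition linf_sum :: "'i set \<Rightarrow> ('i \<Rightarrow> 'b normed) \<Rightarrow> ('i \<Rightarrow> 'b) normed"
  where "linf_sum I Y =
    \<lparr>carrier = {y \<in> (\<Pi>\<^sub>E i\<in>I. carrier (Y i)). bdd_above ((\<lambda>i. vnorm (Y i) (y i)) ` I)},
     mult = undefined, one = undefined,
     zero = (\<lambda>i\<in>I. \<zero>\<^bsub>Y i\<^esub>),
     add = (\<lambda>x y. \<lambda>i\<in>I. x i \<oplus>\<^bsub>Y i\<^esub> y i),
     smult = (\<lambda>a x. \<lambda>i\<in>I. a \<odot>\<^bsub>Y i\<^esub> x i),
     vnorm = (\<lambda>y. SUP i\<in>I. vnorm (Y i) (y i))\<rparr>"

definition c0_sum :: "'i set \<Rightarrow> ('i \<Rightarrow> 'b normed) \<Rightarrow> ('i \<Rightarrow> 'b) normed"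
  where "c0_sum I Y = (linf_sum I Y)
    \<lparr>carrier := {y \<in> carrier (linf_sum I Y). \<forall>\<delta>>0. finite {i \<in> I. vnorm (Y i) (y i) > \<delta>}}\<rparr>"

section \<open>Lipschitz maps on a pointed metric space\<close>

text \<open>
  The metric space is the whole type \<open>'m\<close> with distinguished point \<open>z\<close>. Inserting \<open>0\<close> below does
  not affect the supremum of the (nonnegative) slopes if there is one, and yields
  \<open>0\<close> if \<open>'m\<close> has a single point, where the set of slopes is empty.
\<close>

definition Lip0 :: "'m::metric_space \<Rightarrow> 'b normed \<Rightarrow> ('m \<Rightarrow> 'b) normed"
  where "Lip0 z V =
    \<lparr>carrier = {F. Lipschitz_continuous_map euclidean_metric (norm_metric V) F \<and> F z = \<zero>\<^bsub>V\<^esub>},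
     mult = undefined, one = undefined,
     zero = (\<lambda>p. \<zero>\<^bsub>V\<^esub>),
     add = (\<lambda>F G p. F p \<oplus>\<^bsub>V\<^esub> G p),
     smult = (\<lambda>a F p. a \<odot>\<^bsub>V\<^esub> F p),
     vnorm = (\<lambda>F. Sup (insert 0 {vnorm V (F p \<ominus>\<^bsub>V\<^esub> F q) / dist p q | p q. p \<noteq> q}))\<rparr>"

definition LipSNA :: "'m::metric_space \<Rightarrow> 'b normed \<Rightarrow> ('m \<Rightarrow> 'b) set"
  where "LipSNA z V = {F \<in> carrier (Lip0 z V).
    \<exists>p q. p \<noteq> q \<and> vnorm V (F p \<ominus>\<^bsub>V\<^esub> F q) / dist p q = vnorm (Lip0 z V) F}"

end

theory Submission
  imports Defs
begin

text \<open>
  The Lipschitz norm of \<open>F = (F\<^sub>i)\<close> is the supremum of the norms of the coordinates \<open>F\<^sub>i\<close>. If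
  \<open>F \<noteq> 0\<close>, choose \<open>i\<close> such that the norm of \<open>F\<^sub>i\<close> almost equals that of \<open>F\<close>, approximate \<open>F\<^sub>i\<close> by a
  strongly norm attaining \<open>H\<close>, and rescale \<open>H\<close> so that its norm is exactly that of \<open>F\<close>. Replacing
  \<open>F\<^sub>i\<close> by the rescaled map moves \<open>F\<close> only a little and leaves its norm unchanged, and this norm is
  now attained in the coordinate \<open>i\<close>. The map \<open>F = 0\<close> attains its norm as soon as there are two
  points, which density in the coordinates guarantees: no map on a single point attains its norm.
\<close>

section \<open>Normed spaces\<close>

lemma real_ring_simps [simp]:
  "carrier real_ring = UNIV" "a \<otimes>\<^bsub>real_ring\<^esub> b = a * b" "\<one>\<^bsub>real_ring\<^esub> = 1"
  "\<zero>\<^bsub>real_ring\<^esub> = 0" "a \<oplus>\<^bsub>real_ring\<^esub> b = a + b"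
  by (simp_all add: real_ring_def)

lemma cring_real_ring: "cring real_ring"
proof (rule cringI)
  show "abelian_group real_ring"
    by (rule abelian_groupI) (auto intro: exI [of _ "- x" for x])
  show "Group.comm_monoid real_ring"
    by (rule comm_monoidI) auto
qed (auto simp: algebra_simps)

text \<open>Additive inverses come for free, as \<open>0 \<odot> x\<close> has norm \<open>0\<close>.\<close>

lemma real_normed_spaceI:
  fixes V (structure)
  assumes add_closed: "\<And>x y. \<lbrakk>x \<in> carrier V; y \<in> carrier V\<rbrakk> \<Longrightarrow> x \<oplus> y \<in> carrier V"
    and zero_closed: "\<zero> \<in> carrier V"
    and smult_closed: "\<And>a x. x \<in> carrier V \<Longrightarrow> a \<odot>\<^bsub>V\<^esub> x \<in> carrier V"
    and assoc: "\<And>x y w. \<lbrakk>x \<in> carrier V; y \<in> carrier V; w \<in> carrier V\<rbrakk>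
      \<Longrightarrow> (x \<oplus> y) \<oplus> w = x \<oplus> (y \<oplus> w)"
    and comm: "\<And>x y. \<lbrakk>x \<in> carrier V; y \<in> carrier V\<rbrakk> \<Longrightarrow> x \<oplus> y = y \<oplus> x"
    and l_zero: "\<And>x. x \<in> carrier V \<Longrightarrow> \<zero> \<oplus> x = x"
    and l_distr: "\<And>a b x. x \<in> carrier V \<Longrightarrow> (a + b) \<odot>\<^bsub>V\<^esub> x = a \<odot>\<^bsub>V\<^esub> x \<oplus> b \<odot>\<^bsub>V\<^esub> x"
    and r_distr: "\<And>a x y. \<lbrakk>x \<in> carrier V; y \<in> carrier V\<rbrakk>
      \<Longrightarrow> a \<odot>\<^bsub>V\<^esub> (x \<oplus> y) = a \<odot>\<^bsub>V\<^esub> x \<oplus> a \<odot>\<^bsub>V\<^esub> y"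
    and assoc1: "\<And>a b x. x \<in> carrier V \<Longrightarrow> (a * b) \<odot>\<^bsub>V\<^esub> x = a \<odot>\<^bsub>V\<^esub> (b \<odot>\<^bsub>V\<^esub> x)"
    and one: "\<And>x. x \<in> carrier V \<Longrightarrow> 1 \<odot>\<^bsub>V\<^esub> x = x"
    and nonneg: "\<And>x. x \<in> carrier V \<Longrightarrow> 0 \<le> vnorm V x"
    and norm_zero: "vnorm V \<zero> = 0"
    and norm_eq_0: "\<And>x. \<lbrakk>x \<in> carrier V; vnorm V x = 0\<rbrakk> \<Longrightarrow> x = \<zero>"
    and triangle: "\<And>x y. \<lbrakk>x \<in> carrier V; y \<in> carrier V\<rbrakk>
      \<Longrightarrow> vnorm V (x \<oplus> y) \<le> vnorm V x + vnorm V y"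
    and norm_smult_le: "\<And>a x. x \<in> carrier V \<Longrightarrow> vnorm V (a \<odot>\<^bsub>V\<^esub> x) \<le> \<bar>a\<bar> * vnorm V x"
  shows "real_normed_space V"
proof -
  have smult_0: "0 \<odot>\<^bsub>V\<^esub> x = \<zero>" if "x \<in> carrier V" for x
    using norm_eq_0 [of "0 \<odot>\<^bsub>V\<^esub> x"] norm_smult_le [of x 0] nonneg [of "0 \<odot>\<^bsub>V\<^esub> x"]
      smult_closed that by force
  \<comment> \<open>Distributivity over \<open>-1 + 1 = 0\<close> makes
    \<open>(-1) \<odot> x\<close> an additive inverse of \<open>x\<close>.\<close>
  have inverse: "\<exists>y\<in>carrier V. y \<oplus> x = \<zero>" if "x \<in> carrier V" for x
    using l_distr [of x "-1" 1] one smult_0 smult_closed that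
    by (intro bexI [of _ "(-1) \<odot>\<^bsub>V\<^esub> x"]) auto
  have norm_smult: "vnorm V (a \<odot>\<^bsub>V\<^esub> x) = \<bar>a\<bar> * vnorm V x" if x: "x \<in> carrier V" for a x
  proof (cases "a = 0")
    case False
    \<comment> \<open>Only the upper bound is assumed. Applied to the scalar
      \<open>inverse a\<close> and the vector \<open>a \<odot> x\<close>, it yields the lower
      bound.\<close>
    have "vnorm V x = vnorm V (inverse a \<odot>\<^bsub>V\<^esub> (a \<odot>\<^bsub>V\<^esub> x))"
      using False one x by (simp flip: assoc1)
    also have "\<dots> \<le> \<bar>inverse a\<bar> * vnorm V (a \<odot>\<^bsub>V\<^esub> x)"
      using norm_smult_le smult_closed x by blast
    finally have "\<bar>a\<bar> * vnorm V x \<le> vnorm V (a \<odot>\<^bsub>V\<^esub> x)"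
      using False by (simp add: field_simps abs_inverse)
    with norm_smult_le x show ?thesis
      by (simp add: antisym)
  qed (simp add: norm_zero smult_0 x)
  have "abelian_group V"
    using add_closed zero_closed assoc comm l_zero inverse by (rule abelian_groupI)
  then have "module real_ring V"
    using cring_real_ring smult_closed l_distr r_distr assoc1 one by (intro moduleI) auto
  then show ?thesis
    using norm_zero norm_eq_0 triangle norm_smult
    by (auto intro!: real_normed_space.intro real_normed_space_axioms.intro)
qed

section \<open>Arithmetic, norm and metric of a normed space\<close>

context real_normed_space
begin

text \<open>Additive inverses are given by a description, not by a record field. This rule reduces
  differences to addition and scalar multiplication, which are explicit in sums and in
  \<open>Lip0\<close>; the pointwise formulas for differences there rest on it.\<close>

lemma a_minus_eq_smult:
  assumes "x \<in> carrier V" "y \<in> carrier V"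
  shows "x \<ominus> y = x \<oplus> (-1) \<odot>\<^bsub>V\<^esub> y"
proof -
  have "(-1) \<odot>\<^bsub>V\<^esub> y \<oplus> y = \<zero>"
    using smult_l_distr [of "-1" 1 y] smult_one [of y] smult_l_null [of y] assms by simp
  then have "\<ominus> y = (-1) \<odot>\<^bsub>V\<^esub> y"
    using assms by (intro M.minus_equality) auto
  then show ?thesis
    by (simp add: a_minus_def)
qed

lemma vnorm_zero: "vnorm V \<zero> = 0"
  by (simp add: vnorm_eq_0_iff)

lemma vnorm_a_minus_commute:
  assumes "x \<in> carrier V" "y \<in> carrier V"
  shows "vnorm V (x \<ominus> y) = vnorm V (y \<ominus> x)"
proof -
  have "(-1) \<odot>\<^bsub>V\<^esub> (x \<ominus> y) = (-1) \<odot>\<^bsub>V\<^esub> x \<oplus> y"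
    using assms smult_assoc1 [of "-1" "-1" y] smult_one [of y]
    by (simp add: a_minus_eq_smult smult_r_distr)
  also have "\<dots> = y \<ominus> x"
    using assms by (simp add: a_minus_eq_smult M.a_comm)
  finally show ?thesis
    using vnorm_smult [of "x \<ominus> y" "-1"] assms by simp
qed

text \<open>Nonnegativity is not an axiom of the locale. It follows from 0 = ||x - x|| \<le> ||x|| +
  ||-x|| = 2 ||x||.\<close>

lemma vnorm_nonneg:
  assumes "x \<in> carrier V"
  shows "0 \<le> vnorm V x"
proof -
  have "x \<ominus> x = \<zero>"
    using assms by (simp add: M.r_neg a_minus_def)
  then show ?thesis
    using vnorm_triangle [of x "(-1) \<odot>\<^bsub>V\<^esub> x"] vnorm_smult [of x "-1"] assms
    by (simp add: a_minus_eq_smult vnorm_zero)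
qed

lemma a_minus_add_a_minus:
  assumes "x \<in> carrier V" "y \<in> carrier V" "w \<in> carrier V"
  shows "(x \<ominus> y) \<oplus> (y \<ominus> w) = x \<ominus> w"
proof -
  have "(\<ominus> y \<oplus> y) \<oplus> \<ominus> w = \<ominus> w"
    using assms by (simp add: M.l_neg)
  then show ?thesis
    using assms by (simp add: a_minus_def M.a_assoc)
qed

lemma add_a_minus_add:
  assumes "x \<in> carrier V" "y \<in> carrier V" "u \<in> carrier V" "v \<in> carrier V"
  shows "(x \<oplus> y) \<ominus> (u \<oplus> v) = (x \<ominus> u) \<oplus> (y \<ominus> v)"
  using assms by (simp add: a_minus_eq_smult smult_r_distr M.a_ac)

lemma smult_a_minus:
  assumes "x \<in> carrier V" "y \<in> carrier V"
  shows "a \<odot>\<^bsub>V\<^esub> (x \<ominus> y) = a \<odot>\<^bsub>V\<^esub> x \<ominus> a \<odot>\<^bsub>V\<^esub> y"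
  using assms smult_assoc1 [of a "-1" y] smult_assoc1 [of "-1" a y]
  by (simp add: a_minus_eq_smult smult_r_distr)

lemma a_minus_eq_zero_iff:
  assumes "x \<in> carrier V" "y \<in> carrier V"
  shows "x \<ominus> y = \<zero> \<longleftrightarrow> x = y"
  using assms by (metis M.add.inv_closed M.minus_equality M.minus_minus M.r_neg a_minus_def)

lemma a_minus_self: "x \<in> carrier V \<Longrightarrow> x \<ominus> x = \<zero>"
  by (simp add: a_minus_eq_zero_iff)

lemma vnorm_a_minus_triangle:
  assumes "x \<in> carrier V" "y \<in> carrier V" "w \<in> carrier V"
  shows "vnorm V (x \<ominus> w) \<le> vnorm V (x \<ominus> y) + vnorm V (y \<ominus> w)"
  using vnorm_triangle [of "x \<ominus> y" "y \<ominus> w"] assms by (simp add: a_minus_add_a_minus)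

lemma vnorm_le_a_minus:
  assumes "x \<in> carrier V" "y \<in> carrier V"
  shows "vnorm V x \<le> vnorm V (x \<ominus> y) + vnorm V y"
proof -
  have "x \<ominus> \<zero> = x" "y \<ominus> \<zero> = y"
    using assms by (simp_all add: a_minus_eq_smult smult_r_null)
  then show ?thesis
    using vnorm_a_minus_triangle [of x y \<zero>] assms by simp
qed

text \<open>The distance repeats the one inside \<open>norm_metric\<close>, so that unfolding
  \<open>norm_metric_def\<close> exposes the metric of this interpretation.\<close>

sublocale norm_metric: Metric_space "carrier V"
  "\<lambda>x y. if x \<in> carrier V \<and> y \<in> carrier V then vnorm V (x \<ominus> y) else 0"
  by standard
    (auto simp: vnorm_nonneg vnorm_a_minus_commute vnorm_eq_0_iff a_minus_eq_zero_iff
      vnorm_a_minus_triangle)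

lemma mspace_norm_metric: "mspace (norm_metric V) = carrier V"
  by (simp add: norm_metric_def)

lemma mdist_norm_metric:
  "\<lbrakk>x \<in> carrier V; y \<in> carrier V\<rbrakk> \<Longrightarrow> mdist (norm_metric V) x y = vnorm V (x \<ominus> y)"
  by (simp add: norm_metric_def)

text \<open>Closures in a metric space are described by balls, and the ball around \<open>x\<close>
  consists of the vectors at small norm distance from \<open>x\<close>. Density is handled only in
  this epsilon form below.\<close>

lemma closure_of_eq_carrier_iff:
  assumes "S \<subseteq> carrier V"
  shows "mtopology_of (norm_metric V) closure_of S = carrier V \<longleftrightarrow>
    (\<forall>x\<in>carrier V. \<forall>e>0. \<exists>y\<in>S. vnorm V (x \<ominus> y) < e)"
proof -
  have "y \<in> norm_metric.mball x e \<longleftrightarrow> vnorm V (x \<ominus> y) < e"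
    if "x \<in> carrier V" "y \<in> S" for x y e
    using assms that by (auto simp: norm_metric.in_mball)
  then show ?thesis
    unfolding norm_metric_def norm_metric.mtopology_of norm_metric.metric_closure_of by blast
qed

end

section \<open>Lipschitz maps into a normed space\<close>

locale lipschitz_maps = real_normed_space V for V :: "'b normed" (structure) +
  fixes z :: "'m::metric_space"
begin

lemma in_carrier_Lip0_iff:
  "F \<in> carrier (Lip0 z V) \<longleftrightarrow> (\<forall>p. F p \<in> carrier V) \<and> F z = \<zero> \<and>
    (\<exists>B. \<forall>p q. vnorm V (F p \<ominus> F q) \<le> B * dist p q)"
proof -
  \<comment> \<open>The metric is the norm of the difference only on the carrier, so the values of
    \<open>F\<close> must be known to lie there first.\<close>
  have "mdist (norm_metric V) (F p) (F q) = vnorm V (F p \<ominus> F q)"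
    if "\<forall>p. F p \<in> carrier V" for p q
    using that by (intro mdist_norm_metric) auto
  then show ?thesis
    by (auto simp: Lip0_def Lipschitz_continuous_map_def mspace_norm_metric Pi_iff
        simp del: ex_simps) blast+
qed

lemma Lip0_simps:
  "\<zero>\<^bsub>Lip0 z V\<^esub> = (\<lambda>p. \<zero>)" "F \<oplus>\<^bsub>Lip0 z V\<^esub> G = (\<lambda>p. F p \<oplus> G p)"
  "a \<odot>\<^bsub>Lip0 z V\<^esub> F = (\<lambda>p. a \<odot>\<^bsub>V\<^esub> F p)"
  by (simp_all add: Lip0_def)

lemma Lip0_closed: "F \<in> carrier (Lip0 z V) \<Longrightarrow> F p \<in> carrier V"
  by (simp add: in_carrier_Lip0_iff)

abbreviation slopes :: "('m \<Rightarrow> 'b) \<Rightarrow> real set"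
  where "slopes F \<equiv> {vnorm V (F p \<ominus> F q) / dist p q | p q. p \<noteq> q}"

lemma vnorm_Lip0: "vnorm (Lip0 z V) F = Sup (insert 0 (slopes F))"
  by (simp add: Lip0_def)

lemma bdd_above_slopes:
  assumes "F \<in> carrier (Lip0 z V)"
  shows "bdd_above (insert 0 (slopes F))"
proof -
  obtain B where "\<And>p q. vnorm V (F p \<ominus> F q) \<le> B * dist p q"
    using assms in_carrier_Lip0_iff by blast
  then have "vnorm V (F p \<ominus> F q) / dist p q \<le> B" if "p \<noteq> q" for p q
    using that by (simp add: divide_simps)
  \<comment> \<open>The bound has to cover the inserted \<open>0\<close> as well, and
    \<open>B\<close> may be negative if the metric space is a single point.\<close>
  then show ?thesis
    by (intro bdd_aboveI [where M = "max 0 B"]) (auto simp: le_max_iff_disj)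
qed

lemma vnorm_Lip0_nonneg: "F \<in> carrier (Lip0 z V) \<Longrightarrow> 0 \<le> vnorm (Lip0 z V) F"
  unfolding vnorm_Lip0 using bdd_above_slopes by (intro cSup_upper) simp_all

lemma vnorm_diff_le_Lip0:
  assumes "F \<in> carrier (Lip0 z V)"
  shows "vnorm V (F p \<ominus> F q) \<le> vnorm (Lip0 z V) F * dist p q"
proof (cases "p = q")
  case True
  then show ?thesis
    using Lip0_closed [OF assms] by (simp add: a_minus_self vnorm_zero)
next
  case False
  then have "vnorm V (F p \<ominus> F q) / dist p q \<le> vnorm (Lip0 z V) F"
    unfolding vnorm_Lip0 by (intro cSup_upper bdd_above_slopes assms) auto
  then show ?thesis
    using False by (simp add: divide_simps)
qed

text \<open>A Lipschitz constant bounds all slopes; its nonnegativity takes care of the inserted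
  \<open>0\<close>.\<close>

lemma vnorm_Lip0_le:
  assumes "0 \<le> C" "\<And>p q. vnorm V (F p \<ominus> F q) \<le> C * dist p q"
  shows "vnorm (Lip0 z V) F \<le> C"
proof -
  have "vnorm V (F p \<ominus> F q) / dist p q \<le> C" if "p \<noteq> q" for p q
    using that assms(2) [of p q] by (simp add: divide_simps)
  with assms(1) show ?thesis
    unfolding vnorm_Lip0 by (intro cSup_least) auto
qed

lemma in_carrier_Lip0I:
  assumes "\<And>p. F p \<in> carrier V" "F z = \<zero>" "\<And>p q. vnorm V (F p \<ominus> F q) \<le> B * dist p q"
  shows "F \<in> carrier (Lip0 z V)"
  using assms in_carrier_Lip0_iff by blast

text \<open>The explicit constant serves twice: it shows that the sum is Lipschitz, and it gives the
  triangle inequality for the Lipschitz norm.\<close>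

lemma vnorm_add_diff_le_Lip0:
  assumes "F \<in> carrier (Lip0 z V)" "G \<in> carrier (Lip0 z V)"
  shows "vnorm V ((F p \<oplus> G p) \<ominus> (F q \<oplus> G q))
    \<le> (vnorm (Lip0 z V) F + vnorm (Lip0 z V) G) * dist p q"
proof -
  note closed = Lip0_closed [OF assms(1)] Lip0_closed [OF assms(2)]
  have "vnorm V ((F p \<oplus> G p) \<ominus> (F q \<oplus> G q))
      \<le> vnorm V (F p \<ominus> F q) + vnorm V (G p \<ominus> G q)"
    using closed by (simp add: add_a_minus_add vnorm_triangle)
  also have "\<dots> \<le> vnorm (Lip0 z V) F * dist p q + vnorm (Lip0 z V) G * dist p q"
    by (intro add_mono vnorm_diff_le_Lip0 assms)
  finally show ?thesis
    by (simp add: distrib_right)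
qed

lemma vnorm_smult_diff_le_Lip0:
  assumes "F \<in> carrier (Lip0 z V)"
  shows "vnorm V (a \<odot>\<^bsub>V\<^esub> F p \<ominus> a \<odot>\<^bsub>V\<^esub> F q) \<le> (\<bar>a\<bar> * vnorm (Lip0 z V) F) * dist p q"
proof -
  have "vnorm V (a \<odot>\<^bsub>V\<^esub> F p \<ominus> a \<odot>\<^bsub>V\<^esub> F q) = \<bar>a\<bar> * vnorm V (F p \<ominus> F q)"
    using Lip0_closed [OF assms] by (simp add: vnorm_smult flip: smult_a_minus)
  then show ?thesis
    using vnorm_diff_le_Lip0 [OF assms, of p q] by (simp add: mult.assoc mult_left_mono)
qed

lemma real_normed_space_Lip0: "real_normed_space (Lip0 z V)"
proof (rule real_normed_spaceI, unfold Lip0_simps)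
  have zero_diff: "\<zero> \<ominus> \<zero> = \<zero>"
    by (simp add: a_minus_self)
  show zero: "(\<lambda>p. \<zero>) \<in> carrier (Lip0 z V)"
    by (rule in_carrier_Lip0I [where B = 0]) (simp_all add: zero_diff vnorm_zero)
  show "vnorm (Lip0 z V) (\<lambda>p. \<zero>) = 0"
    by (rule antisym [OF vnorm_Lip0_le vnorm_Lip0_nonneg [OF zero]])
      (simp_all add: zero_diff vnorm_zero)
next
  fix F G assume FG: "F \<in> carrier (Lip0 z V)" "G \<in> carrier (Lip0 z V)"
  show "(\<lambda>p. F p \<oplus> G p) \<in> carrier (Lip0 z V)"
    using FG vnorm_add_diff_le_Lip0 [OF FG]
    by (intro in_carrier_Lip0I) (auto simp: in_carrier_Lip0_iff)
  show "vnorm (Lip0 z V) (\<lambda>p. F p \<oplus> G p) \<le> vnorm (Lip0 z V) F + vnorm (Lip0 z V) G"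
    using FG vnorm_add_diff_le_Lip0 [OF FG] vnorm_Lip0_nonneg by (intro vnorm_Lip0_le) auto
next
  fix F and a :: real assume F: "F \<in> carrier (Lip0 z V)"
  show "(\<lambda>p. a \<odot>\<^bsub>V\<^esub> F p) \<in> carrier (Lip0 z V)"
    using F vnorm_smult_diff_le_Lip0 [OF F, of a]
    by (intro in_carrier_Lip0I) (auto simp: in_carrier_Lip0_iff smult_r_null)
  show "vnorm (Lip0 z V) (\<lambda>p. a \<odot>\<^bsub>V\<^esub> F p) \<le> \<bar>a\<bar> * vnorm (Lip0 z V) F"
    using F vnorm_smult_diff_le_Lip0 [OF F, of a] vnorm_Lip0_nonneg by (intro vnorm_Lip0_le) auto
next
  fix F assume F: "F \<in> carrier (Lip0 z V)" "vnorm (Lip0 z V) F = 0"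
  \<comment> \<open>A map with Lipschitz constant 0 is constant, and its value at the distinguished
    point is zero.\<close>
  have "F p = \<zero>" for p
  proof -
    have "vnorm V (F p \<ominus> F z) = 0"
      using vnorm_diff_le_Lip0 [OF F(1), of p z] F vnorm_nonneg [of "F p \<ominus> F z"]
      by (simp add: Lip0_closed)
    then show ?thesis
      using F(1) vnorm_eq_0_iff [of "F p \<ominus> F z"] a_minus_eq_zero_iff [of "F p" "F z"]
      by (simp add: in_carrier_Lip0_iff)
  qed
  then show "F = (\<lambda>p. \<zero>)" ..
qed (use Lip0_closed smult_l_distr smult_r_distr smult_assoc1 smult_one in
  \<open>auto simp: vnorm_Lip0_nonneg M.a_ac fun_eq_iff\<close>)

lemma Lip0_a_minus:
  assumes "F \<in> carrier (Lip0 z V)" "G \<in> carrier (Lip0 z V)"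
  shows "F \<ominus>\<^bsub>Lip0 z V\<^esub> G = (\<lambda>p. F p \<ominus> G p)"
  using real_normed_space.a_minus_eq_smult [OF real_normed_space_Lip0 assms] assms
  by (simp add: Lip0_simps a_minus_eq_smult Lip0_closed)

lemma closure_LipSNA_iff:
  "mtopology_of (norm_metric (Lip0 z V)) closure_of LipSNA z V = carrier (Lip0 z V) \<longleftrightarrow>
    (\<forall>F\<in>carrier (Lip0 z V). \<forall>e>0. \<exists>G\<in>LipSNA z V. vnorm (Lip0 z V) (F \<ominus>\<^bsub>Lip0 z V\<^esub> G) < e)"
  by (rule real_normed_space.closure_of_eq_carrier_iff [OF real_normed_space_Lip0])
    (auto simp: LipSNA_def)

end

section \<open>Spaces of bounded families\<close>

text \<open>
  Both kinds of sums are subspaces \<open>W\<close> of the \<open>\<ell>\<^sub>\<infinity>\<close>-sum in which a single coordinate can be changed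
  at will, and this is all that the argument needs.
\<close>

locale coordinate_sum =
  fixes I :: "'i set" and Y :: "'i \<Rightarrow> 'b normed" and W :: "('i \<Rightarrow> 'b) set"
  assumes nonempty: "I \<noteq> {}"
    and normed: "i \<in> I \<Longrightarrow> real_normed_space (Y i)"
    and subset: "W \<subseteq> carrier (linf_sum I Y)"
    and zero_mem: "(\<lambda>i\<in>I. \<zero>\<^bsub>Y i\<^esub>) \<in> W"
    and add_mem: "\<lbrakk>x \<in> W; y \<in> W\<rbrakk> \<Longrightarrow> (\<lambda>i\<in>I. x i \<oplus>\<^bsub>Y i\<^esub> y i) \<in> W"
    and smult_mem: "x \<in> W \<Longrightarrow> (\<lambda>i\<in>I. a \<odot>\<^bsub>Y i\<^esub> x i) \<in> W"
    and upd_mem: "\<lbrakk>x \<in> W; i \<in> I; v \<in> carrier (Y i)\<rbrakk> \<Longrightarrow> x(i := v) \<in> W"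
begin

text \<open>Both kinds of sums share the operations and the norm of \<open>linf_sum\<close>, so
  exchanging the carrier alone recovers either of them.\<close>

definition sum_space :: "('i \<Rightarrow> 'b) normed"
  where "sum_space = (linf_sum I Y)\<lparr>carrier := W\<rparr>"

lemma sum_space_simps:
  "carrier sum_space = W" "\<zero>\<^bsub>sum_space\<^esub> = (\<lambda>i\<in>I. \<zero>\<^bsub>Y i\<^esub>)"
  "x \<oplus>\<^bsub>sum_space\<^esub> y = (\<lambda>i\<in>I. x i \<oplus>\<^bsub>Y i\<^esub> y i)"
  "a \<odot>\<^bsub>sum_space\<^esub> x = (\<lambda>i\<in>I. a \<odot>\<^bsub>Y i\<^esub> x i)"
  "vnorm sum_space x = (SUP i\<in>I. vnorm (Y i) (x i))"
  by (simp_all add: sum_space_def linf_sum_def)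

lemma coordinate_closed: "\<lbrakk>x \<in> W; i \<in> I\<rbrakk> \<Longrightarrow> x i \<in> carrier (Y i)"
  using subset by (auto simp: linf_sum_def)

text \<open>The families are extensional functions: outside \<open>I\<close> all of them take the
  value \<open>undefined\<close>.\<close>

lemma W_ext: "\<lbrakk>x \<in> W; y \<in> W; \<And>i. i \<in> I \<Longrightarrow> x i = y i\<rbrakk> \<Longrightarrow> x = y"
  using subset by (intro PiE_ext [of x I "\<lambda>i. carrier (Y i)" y]) (auto simp: linf_sum_def)

lemma vnorm_coordinate_le:
  assumes "x \<in> W" "i \<in> I"
  shows "vnorm (Y i) (x i) \<le> vnorm sum_space x"
  unfolding sum_space_simps using subset assms by (intro cSUP_upper) (auto simp: linf_sum_def)

text \<open>Here \<open>I\<close> must be nonempty, as the supremum of an empty set of reals carries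
  no meaning.\<close>

lemma vnorm_sum_space_le:
  "(\<And>i. i \<in> I \<Longrightarrow> vnorm (Y i) (x i) \<le> C) \<Longrightarrow> vnorm sum_space x \<le> C"
  unfolding sum_space_simps using nonempty by (intro cSUP_least)

lemma vnorm_sum_space_nonneg:
  assumes "x \<in> W"
  shows "0 \<le> vnorm sum_space x"
proof -
  obtain i where "i \<in> I"
    using nonempty by blast
  then show ?thesis
    using vnorm_coordinate_le [OF assms] coordinate_closed [OF assms]
      real_normed_space.vnorm_nonneg [OF normed] order_trans by metis
qed

lemma module_Y: "i \<in> I \<Longrightarrow> module real_ring (Y i)"
  using normed by (simp add: real_normed_space_def)

lemma abelian_group_Y: "i \<in> I \<Longrightarrow> abelian_group (Y i)"
  using module_Y by (simp add: module_def)

lemma abelian_monoid_Y: "i \<in> I \<Longrightarrow> abelian_monoid (Y i)"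
  using abelian_group_Y by (simp add: abelian_group_def)

lemma real_normed_space_sum_space: "real_normed_space sum_space"
proof (rule real_normed_spaceI)
  note facts = real_normed_space.vnorm_zero [OF normed] real_normed_space.vnorm_triangle [OF normed]
    real_normed_space.vnorm_smult [OF normed]
  show "\<And>x. x \<in> carrier sum_space \<Longrightarrow> 0 \<le> vnorm sum_space x"
    by (simp add: vnorm_sum_space_nonneg sum_space_simps(1))
  show "vnorm sum_space \<zero>\<^bsub>sum_space\<^esub> = 0"
    using vnorm_sum_space_nonneg [OF zero_mem]
    by (intro antisym vnorm_sum_space_le) (auto simp: facts sum_space_simps(2))
  show "x = \<zero>\<^bsub>sum_space\<^esub>" if "x \<in> carrier sum_space" "vnorm sum_space x = 0" for x
  proof (rule W_ext)
    fix i assume i: "i \<in> I"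
    then interpret real_normed_space "Y i"
      by (rule normed)
    \<comment> \<open>The supremum norm dominates the norm of every coordinate.\<close>
    have "x i \<in> carrier (Y i)" "vnorm (Y i) (x i) \<le> 0"
      using vnorm_coordinate_le [of x i] coordinate_closed that i by (auto simp: sum_space_simps(1))
    then show "x i = \<zero>\<^bsub>sum_space\<^esub> i"
      using vnorm_nonneg [of "x i"] vnorm_eq_0_iff [of "x i"] i by (simp add: sum_space_simps(2))
  qed (use that zero_mem in \<open>simp_all add: sum_space_simps(1,2)\<close>)
  show "vnorm sum_space (x \<oplus>\<^bsub>sum_space\<^esub> y) \<le> vnorm sum_space x + vnorm sum_space y"
    if "x \<in> carrier sum_space" "y \<in> carrier sum_space" for x y
  proof (rule vnorm_sum_space_le)
    fix i assume i: "i \<in> I"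
    then have "vnorm (Y i) (x i \<oplus>\<^bsub>Y i\<^esub> y i) \<le> vnorm (Y i) (x i) + vnorm (Y i) (y i)"
      using that by (intro facts coordinate_closed) (simp_all add: sum_space_simps(1))
    also have "\<dots> \<le> vnorm sum_space x + vnorm sum_space y"
      using that i by (intro add_mono vnorm_coordinate_le) (simp_all add: sum_space_simps(1))
    finally show "vnorm (Y i) ((x \<oplus>\<^bsub>sum_space\<^esub> y) i) \<le> vnorm sum_space x + vnorm sum_space y"
      using i by (simp add: sum_space_simps(3))
  qed
  show "vnorm sum_space (a \<odot>\<^bsub>sum_space\<^esub> x) \<le> \<bar>a\<bar> * vnorm sum_space x"
    if "x \<in> carrier sum_space" for a x
    using that vnorm_coordinate_le [of x] coordinate_closed [of x]
    by (intro vnorm_sum_space_le)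
      (simp add: facts sum_space_simps(1,4) mult_left_mono)
  \<comment> \<open>In the other algebraic laws both sides are restrictions to \<open>I\<close>.
    Here the right-hand side is a bare \<open>x\<close>, so the extensionality of the members of
    \<open>W\<close> enters.\<close>
  show "\<zero>\<^bsub>sum_space\<^esub> \<oplus>\<^bsub>sum_space\<^esub> x = x" "1 \<odot>\<^bsub>sum_space\<^esub> x = x"
    if x: "x \<in> carrier sum_space" for x
  proof -
    have "\<zero>\<^bsub>Y i\<^esub> \<oplus>\<^bsub>Y i\<^esub> x i = x i" "1 \<odot>\<^bsub>Y i\<^esub> x i = x i" if "i \<in> I" for i
      using x that abelian_monoid.l_zero [OF abelian_monoid_Y] module.smult_one [OF module_Y]
        coordinate_closed by (simp_all add: sum_space_simps(1))
    then show "\<zero>\<^bsub>sum_space\<^esub> \<oplus>\<^bsub>sum_space\<^esub> x = x" "1 \<odot>\<^bsub>sum_space\<^esub> x = x"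
      using x add_mem [OF zero_mem] smult_mem [of x 1]
      by (auto intro!: W_ext simp: sum_space_simps(1-4))
  qed
  show "x \<oplus>\<^bsub>sum_space\<^esub> y = y \<oplus>\<^bsub>sum_space\<^esub> x"
    if "x \<in> carrier sum_space" "y \<in> carrier sum_space" for x y
    using that abelian_monoid.a_comm [OF abelian_monoid_Y] coordinate_closed
    by (auto intro!: restrict_ext simp: sum_space_simps(1,3))
qed (use abelian_monoid.a_assoc [OF abelian_monoid_Y] module.smult_l_distr [OF module_Y]
    module.smult_r_distr [OF module_Y] module.smult_assoc1 [OF module_Y] coordinate_closed in
  \<open>auto intro!: restrict_ext simp: sum_space_simps(1-4) zero_mem add_mem smult_mem\<close>)

lemma sum_space_a_minus:
  assumes "x \<in> W" "y \<in> W"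
  shows "x \<ominus>\<^bsub>sum_space\<^esub> y = (\<lambda>i\<in>I. x i \<ominus>\<^bsub>Y i\<^esub> y i)"
  using real_normed_space.a_minus_eq_smult [OF real_normed_space_sum_space, of x y] assms
    real_normed_space.a_minus_eq_smult [OF normed] coordinate_closed
  by (auto intro!: restrict_ext simp: sum_space_simps(1-4))

end

section \<open>The two concrete sums as coordinate sums\<close>

lemma bdd_above_image_fun_upd:
  fixes n :: "'i \<Rightarrow> 'b \<Rightarrow> real"
  assumes "bdd_above ((\<lambda>j. n j (x j)) ` I)"
  shows "bdd_above ((\<lambda>j. n j ((x(i := v)) j)) ` I)"
proof -
  \<comment> \<open>Changing one coordinate brings in at most one new value.\<close>
  have "(\<lambda>j. n j ((x(i := v)) j)) ` I \<subseteq> insert (n i v) ((\<lambda>j. n j (x j)) ` I)"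
    by auto
  with assms show ?thesis
    by (meson bdd_above_insert bdd_above_mono)
qed

lemma coordinate_sum_linf:
  assumes "I \<noteq> {}" and normed: "\<And>i. i \<in> I \<Longrightarrow> real_normed_space (Y i)"
  shows "coordinate_sum I Y (carrier (linf_sum I Y))"
proof (rule coordinate_sum.intro)
  have "\<zero>\<^bsub>Y i\<^esub> \<in> carrier (Y i)" "vnorm (Y i) \<zero>\<^bsub>Y i\<^esub> = 0" if i: "i \<in> I" for i
  proof -
    interpret real_normed_space "Y i"
      using i by (rule normed)
    show "\<zero>\<^bsub>Y i\<^esub> \<in> carrier (Y i)" "vnorm (Y i) \<zero>\<^bsub>Y i\<^esub> = 0"
      by (simp_all add: vnorm_zero)
  qed
  then show "(\<lambda>i\<in>I. \<zero>\<^bsub>Y i\<^esub>) \<in> carrier (linf_sum I Y)"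
    by (auto simp: linf_sum_def intro!: bdd_aboveI [where M = 0])
next
  fix x y assume xy: "x \<in> carrier (linf_sum I Y)" "y \<in> carrier (linf_sum I Y)"
  then obtain A B where "\<forall>i\<in>I. vnorm (Y i) (x i) \<le> A" "\<forall>i\<in>I. vnorm (Y i) (y i) \<le> B"
    by (auto simp: linf_sum_def bdd_above_def)
  note AB = this [rule_format]
  have "x i \<oplus>\<^bsub>Y i\<^esub> y i \<in> carrier (Y i)" "vnorm (Y i) (x i \<oplus>\<^bsub>Y i\<^esub> y i) \<le> A + B" if i: "i \<in> I" for i
  proof -
    interpret real_normed_space "Y i"
      using i by (rule normed)
    have "x i \<in> carrier (Y i)" "y i \<in> carrier (Y i)"
      using xy i by (auto simp: linf_sum_def)
    then show "x i \<oplus>\<^bsub>Y i\<^esub> y i \<in> carrier (Y i)" "vnorm (Y i) (x i \<oplus>\<^bsub>Y i\<^esub> y i) \<le> A + B"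
      using vnorm_triangle [of "x i" "y i"] AB [OF i] by auto
  qed
  then show "(\<lambda>i\<in>I. x i \<oplus>\<^bsub>Y i\<^esub> y i) \<in> carrier (linf_sum I Y)"
    by (auto simp: linf_sum_def intro!: bdd_aboveI [where M = "A + B"])
next
  fix x and a :: real assume x: "x \<in> carrier (linf_sum I Y)"
  then obtain A where A: "\<And>i. i \<in> I \<Longrightarrow> vnorm (Y i) (x i) \<le> A"
    by (auto simp: linf_sum_def bdd_above_def)
  have "a \<odot>\<^bsub>Y i\<^esub> x i \<in> carrier (Y i)" "vnorm (Y i) (a \<odot>\<^bsub>Y i\<^esub> x i) \<le> \<bar>a\<bar> * A" if i: "i \<in> I" for i
  proof -
    interpret real_normed_space "Y i"
      using i by (rule normed)
    have "x i \<in> carrier (Y i)"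
      using x i by (auto simp: linf_sum_def)
    then show "a \<odot>\<^bsub>Y i\<^esub> x i \<in> carrier (Y i)" "vnorm (Y i) (a \<odot>\<^bsub>Y i\<^esub> x i) \<le> \<bar>a\<bar> * A"
      using A [OF i] by (auto simp: vnorm_smult mult_left_mono)
  qed
  then show "(\<lambda>i\<in>I. a \<odot>\<^bsub>Y i\<^esub> x i) \<in> carrier (linf_sum I Y)"
    by (auto simp: linf_sum_def intro!: bdd_aboveI [where M = "\<bar>a\<bar> * A"])
next
  fix x i v assume "x \<in> carrier (linf_sum I Y)" "i \<in> I" "v \<in> carrier (Y i)"
  then show "x(i := v) \<in> carrier (linf_sum I Y)"
    using bdd_above_image_fun_upd [of "\<lambda>j. vnorm (Y j)" x I i v]
    by (auto simp: linf_sum_def PiE_iff extensional_def)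
qed (use assms in auto)

text \<open>Membership in the larger sum comes from \<open>coordinate_sum_linf\<close>. What remains
  is that the set of indices with norm above \<delta> stays finite under each operation.\<close>

lemma coordinate_sum_c0:
  assumes "I \<noteq> {}" and normed: "\<And>i. i \<in> I \<Longrightarrow> real_normed_space (Y i)"
  shows "coordinate_sum I Y (carrier (c0_sum I Y))"
proof -
  interpret linf: coordinate_sum I Y "carrier (linf_sum I Y)"
    using assms by (rule coordinate_sum_linf)
  have carrier_c0: "x \<in> carrier (c0_sum I Y) \<longleftrightarrow>
      x \<in> carrier (linf_sum I Y) \<and> (\<forall>\<delta>>0. finite {i \<in> I. vnorm (Y i) (x i) > \<delta>})" for x
    by (simp add: c0_sum_def)
  show ?thesis
  proof (rule coordinate_sum.intro)
    have "{i \<in> I. vnorm (Y i) ((\<lambda>i\<in>I. \<zero>\<^bsub>Y i\<^esub>) i) > \<delta>} = {}" if "\<delta> > 0" for \<delta> :: real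
      using that real_normed_space.vnorm_zero [OF normed] by auto
    then show "(\<lambda>i\<in>I. \<zero>\<^bsub>Y i\<^esub>) \<in> carrier (c0_sum I Y)"
      unfolding carrier_c0 using linf.zero_mem by simp
  next
    fix x y assume xy: "x \<in> carrier (c0_sum I Y)" "y \<in> carrier (c0_sum I Y)"
    have "finite {i \<in> I. vnorm (Y i) ((\<lambda>i\<in>I. x i \<oplus>\<^bsub>Y i\<^esub> y i) i) > \<delta>}" if "\<delta> > 0" for \<delta> :: real
    proof (rule finite_subset)
      \<comment> \<open>If the norm of a sum exceeds \<delta>, then the norm of one of the summands
        exceeds \<delta> / 2.\<close>
      show "finite ({i \<in> I. vnorm (Y i) (x i) > \<delta> / 2} \<union> {i \<in> I. vnorm (Y i) (y i) > \<delta> / 2})"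
        using xy half_gt_zero [OF that] unfolding carrier_c0 by blast
      have "vnorm (Y i) (x i \<oplus>\<^bsub>Y i\<^esub> y i) \<le> vnorm (Y i) (x i) + vnorm (Y i) (y i)" if "i \<in> I" for i
        using xy that linf.coordinate_closed real_normed_space.vnorm_triangle [OF normed]
        by (simp add: carrier_c0)
      then show "{i \<in> I. vnorm (Y i) ((\<lambda>i\<in>I. x i \<oplus>\<^bsub>Y i\<^esub> y i) i) > \<delta>} \<subseteq>
          {i \<in> I. vnorm (Y i) (x i) > \<delta> / 2} \<union> {i \<in> I. vnorm (Y i) (y i) > \<delta> / 2}"
        by fastforce
    qed
    then show "(\<lambda>i\<in>I. x i \<oplus>\<^bsub>Y i\<^esub> y i) \<in> carrier (c0_sum I Y)"
      using xy linf.add_mem by (simp only: carrier_c0) blast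
  next
    fix x and a :: real assume x: "x \<in> carrier (c0_sum I Y)"
    have norm: "vnorm (Y i) (a \<odot>\<^bsub>Y i\<^esub> x i) = \<bar>a\<bar> * vnorm (Y i) (x i)" if "i \<in> I" for i
      using x that linf.coordinate_closed real_normed_space.vnorm_smult [OF normed]
      by (simp add: carrier_c0)
    have "finite {i \<in> I. vnorm (Y i) ((\<lambda>i\<in>I. a \<odot>\<^bsub>Y i\<^esub> x i) i) > \<delta>}" if "\<delta> > 0" for \<delta> :: real
    \<comment> \<open>The threshold for \<open>x\<close> is \<delta> divided by the absolute value
      of \<open>a\<close>, which makes sense only for nonzero \<open>a\<close>.\<close>
    proof (cases "a = 0")
      case False
      have "{i \<in> I. vnorm (Y i) ((\<lambda>i\<in>I. a \<odot>\<^bsub>Y i\<^esub> x i) i) > \<delta>} =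
          {i \<in> I. vnorm (Y i) (x i) > \<delta> / \<bar>a\<bar>}"
        using False norm by (auto simp: field_simps)
      then show ?thesis
        using x that False by (simp add: carrier_c0)
    next
      case True
      then have "{i \<in> I. vnorm (Y i) ((\<lambda>i\<in>I. a \<odot>\<^bsub>Y i\<^esub> x i) i) > \<delta>} = {}"
        using norm that by auto
      then show ?thesis
        by simp
    qed
    then show "(\<lambda>i\<in>I. a \<odot>\<^bsub>Y i\<^esub> x i) \<in> carrier (c0_sum I Y)"
      using x linf.smult_mem by (simp only: carrier_c0) blast
  next
    fix x i v assume x: "x \<in> carrier (c0_sum I Y)" and i: "i \<in> I" "v \<in> carrier (Y i)"
    have "finite {j \<in> I. vnorm (Y j) ((x(i := v)) j) > \<delta>}" if "\<delta> > 0" for \<delta> :: real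
    proof (rule finite_subset)
      \<comment> \<open>The changed index is the only one that can newly exceed \<delta>.\<close>
      show "finite (insert i {j \<in> I. vnorm (Y j) (x j) > \<delta>})"
        using x that by (simp add: carrier_c0)
    qed auto
    then show "x(i := v) \<in> carrier (c0_sum I Y)"
      using x i linf.upd_mem by (simp only: carrier_c0) blast
  qed (use assms carrier_c0 in auto)
qed

section \<open>Density of norm attaining maps\<close>

context coordinate_sum
begin

section \<open>Lipschitz maps into a sum and their coordinates\<close>

context
  fixes z :: "'m::metric_space"
begin

interpretation sum: lipschitz_maps sum_space z
  by (rule lipschitz_maps.intro [OF real_normed_space_sum_space])

lemma lipschitz_maps_Y: "i \<in> I \<Longrightarrow> lipschitz_maps (Y i)"
  by (rule lipschitz_maps.intro [OF normed])

text \<open>The projection to a coordinate is linear and does not increase norms, so composing with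
  it preserves Lipschitz constants.\<close>

lemma Lip0_coordinate:
  assumes "F \<in> carrier (Lip0 z sum_space)" "i \<in> I"
  shows "(\<lambda>p. F p i) \<in> carrier (Lip0 z (Y i))"
    and "vnorm (Lip0 z (Y i)) (\<lambda>p. F p i) \<le> vnorm (Lip0 z sum_space) F"
proof -
  interpret lipschitz_maps "Y i" z
    using assms(2) by (rule lipschitz_maps_Y)
  have F: "F p \<in> W" for p
    using sum.Lip0_closed [OF assms(1)] by (simp add: sum_space_simps(1))
  have diff: "vnorm (Y i) (F p i \<ominus>\<^bsub>Y i\<^esub> F q i) \<le> vnorm (Lip0 z sum_space) F * dist p q" for p q
  proof -
    have "F p \<ominus>\<^bsub>sum_space\<^esub> F q \<in> W"
      using sum.M.minus_closed F by (simp add: sum_space_simps(1))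
    from vnorm_coordinate_le [OF this assms(2)]
    have "vnorm (Y i) (F p i \<ominus>\<^bsub>Y i\<^esub> F q i) \<le> vnorm sum_space (F p \<ominus>\<^bsub>sum_space\<^esub> F q)"
      by (simp add: sum_space_a_minus F assms(2))
    also have "\<dots> \<le> vnorm (Lip0 z sum_space) F * dist p q"
      by (rule sum.vnorm_diff_le_Lip0 [OF assms(1)])
    finally show ?thesis .
  qed
  show "(\<lambda>p. F p i) \<in> carrier (Lip0 z (Y i))"
    using assms diff coordinate_closed F
    by (intro in_carrier_Lip0I) (auto simp: sum.in_carrier_Lip0_iff sum_space_simps(2))
  show "vnorm (Lip0 z (Y i)) (\<lambda>p. F p i) \<le> vnorm (Lip0 z sum_space) F"
    using diff sum.vnorm_Lip0_nonneg [OF assms(1)] by (intro vnorm_Lip0_le)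
qed

text \<open>Under the supremum norm Lipschitz constants can be checked coordinate by coordinate.
  Coordinate \<open>i\<close> of \<open>G\<close> is \<open>H\<close> and the others come from
  \<open>F\<close>, which gives the maximum; the difference of \<open>F\<close> and \<open>G\<close>
  lives in coordinate \<open>i\<close> alone, which gives the last bound.\<close>

lemma Lip0_fun_upd:
  assumes F: "F \<in> carrier (Lip0 z sum_space)" and i: "i \<in> I"
    and H: "H \<in> carrier (Lip0 z (Y i))"
  defines "G \<equiv> \<lambda>p. (F p)(i := H p)"
  shows "G \<in> carrier (Lip0 z sum_space)"
    and "vnorm (Lip0 z sum_space) G
      \<le> max (vnorm (Lip0 z sum_space) F) (vnorm (Lip0 z (Y i)) H)"
    and "vnorm (Lip0 z sum_space) (F \<ominus>\<^bsub>Lip0 z sum_space\<^esub> G)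
      \<le> vnorm (Lip0 z (Y i)) ((\<lambda>p. F p i) \<ominus>\<^bsub>Lip0 z (Y i)\<^esub> H)"
proof -
  interpret Yi: lipschitz_maps "Y i" z
    using i by (rule lipschitz_maps_Y)
  interpret LY: real_normed_space "Lip0 z (Y i)"
    by (rule Yi.real_normed_space_Lip0)
  have Fp: "F p \<in> W" for p
    using sum.Lip0_closed [OF F] by (simp add: sum_space_simps(1))
  have Gp: "G p \<in> W" for p
    unfolding G_def using Fp i Yi.Lip0_closed [OF H] by (rule upd_mem)
  let ?C = "max (vnorm (Lip0 z sum_space) F) (vnorm (Lip0 z (Y i)) H)"
  have diff: "vnorm sum_space (G p \<ominus>\<^bsub>sum_space\<^esub> G q) \<le> ?C * dist p q" for p q
  proof (rule vnorm_sum_space_le)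
    fix j assume j: "j \<in> I"
    interpret Yj: lipschitz_maps "Y j" z
      using j by (rule lipschitz_maps_Y)
    have "vnorm (Y j) (G p j \<ominus>\<^bsub>Y j\<^esub> G q j) \<le> ?C * dist p q"
    proof (cases "j = i")
      case True
      have "vnorm (Y i) (H p \<ominus>\<^bsub>Y i\<^esub> H q) \<le> vnorm (Lip0 z (Y i)) H * dist p q"
        by (rule Yi.vnorm_diff_le_Lip0 [OF H])
      also have "\<dots> \<le> ?C * dist p q"
        by (intro mult_right_mono) auto
      finally show ?thesis
        using True by (simp add: G_def)
    next
      case False
      have "vnorm (Y j) (F p j \<ominus>\<^bsub>Y j\<^esub> F q j) \<le> vnorm (Lip0 z (Y j)) (\<lambda>p. F p j) * dist p q"
        by (rule Yj.vnorm_diff_le_Lip0 [OF Lip0_coordinate(1) [OF F j]])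
      also have "\<dots> \<le> ?C * dist p q"
        using Lip0_coordinate(2) [OF F j] by (intro mult_right_mono) auto
      finally show ?thesis
        using False by (simp add: G_def)
    qed
    then show "vnorm (Y j) ((G p \<ominus>\<^bsub>sum_space\<^esub> G q) j) \<le> ?C * dist p q"
      using j by (simp add: sum_space_a_minus Gp)
  qed
  have "F z = \<zero>\<^bsub>sum_space\<^esub>" "H z = \<zero>\<^bsub>Y i\<^esub>"
    using F H by (simp_all add: sum.in_carrier_Lip0_iff Yi.in_carrier_Lip0_iff)
  then have "G z = \<zero>\<^bsub>sum_space\<^esub>"
    using i by (auto simp: G_def sum_space_simps(2))
  then show G: "G \<in> carrier (Lip0 z sum_space)"
    using diff Gp by (intro sum.in_carrier_Lip0I) (simp_all add: sum_space_simps(1))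
  show "vnorm (Lip0 z sum_space) G \<le> ?C"
    using diff sum.vnorm_Lip0_nonneg [OF F] by (intro sum.vnorm_Lip0_le) auto
  let ?D = "(\<lambda>p. F p i) \<ominus>\<^bsub>Lip0 z (Y i)\<^esub> H"
  have Fi: "(\<lambda>p. F p i) \<in> carrier (Lip0 z (Y i))"
    using F i by (rule Lip0_coordinate)
  have D: "?D \<in> carrier (Lip0 z (Y i))"
    using Fi H by (rule LY.M.minus_closed)
  have FG: "F p \<ominus>\<^bsub>sum_space\<^esub> G p \<in> W" for p
    using sum.M.minus_closed Fp Gp by (simp add: sum_space_simps(1))
  have "vnorm sum_space
      ((F p \<ominus>\<^bsub>sum_space\<^esub> G p) \<ominus>\<^bsub>sum_space\<^esub> (F q \<ominus>\<^bsub>sum_space\<^esub> G q))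
    \<le> vnorm (Lip0 z (Y i)) ?D * dist p q" for p q
  proof (rule vnorm_sum_space_le)
    fix j assume j: "j \<in> I"
    interpret Yj: lipschitz_maps "Y j" z
      using j by (rule lipschitz_maps_Y)
    have "vnorm (Y j) ((F p j \<ominus>\<^bsub>Y j\<^esub> G p j) \<ominus>\<^bsub>Y j\<^esub> (F q j \<ominus>\<^bsub>Y j\<^esub> G q j))
      \<le> vnorm (Lip0 z (Y i)) ?D * dist p q"
    \<comment> \<open>Off \<open>i\<close> the maps \<open>F\<close> and \<open>G\<close> agree, so
      that coordinate of the difference is zero.\<close>
    proof (cases "j = i")
      case True
      then show ?thesis
        using Yi.vnorm_diff_le_Lip0 [OF D, of p q] Fi H by (simp add: G_def Yi.Lip0_a_minus)
    next
      case False
      then show ?thesis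
        using coordinate_closed [OF Fp j] Yi.vnorm_Lip0_nonneg [OF D]
        by (simp add: G_def Yj.a_minus_self Yj.vnorm_zero)
    qed
    then show "vnorm (Y j)
        (((F p \<ominus>\<^bsub>sum_space\<^esub> G p) \<ominus>\<^bsub>sum_space\<^esub> (F q \<ominus>\<^bsub>sum_space\<^esub> G q)) j)
      \<le> vnorm (Lip0 z (Y i)) ?D * dist p q"
      using j FG by (simp add: sum_space_a_minus Fp Gp)
  qed
  then show "vnorm (Lip0 z sum_space) (F \<ominus>\<^bsub>Lip0 z sum_space\<^esub> G)
      \<le> vnorm (Lip0 z (Y i)) ?D"
    unfolding sum.Lip0_a_minus [OF F G] using Yi.vnorm_Lip0_nonneg [OF D]
    by (intro sum.vnorm_Lip0_le)
qed

text \<open>A common bound \<open>c\<close> for the norms of all coordinates would be a Lipschitz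
  constant of \<open>F\<close>.\<close>

lemma ex_coordinate_norm_gt:
  assumes F: "F \<in> carrier (Lip0 z sum_space)" and c: "0 \<le> c" "c < vnorm (Lip0 z sum_space) F"
  obtains i where "i \<in> I" "c < vnorm (Lip0 z (Y i)) (\<lambda>p. F p i)"
proof (rule ccontr)
  assume "\<not> thesis"
  then have le: "vnorm (Lip0 z (Y i)) (\<lambda>p. F p i) \<le> c" if "i \<in> I" for i
    using that \<open>\<And>i. i \<in> I \<Longrightarrow> c < vnorm (Lip0 z (Y i)) (\<lambda>p. F p i) \<Longrightarrow> thesis\<close> by force
  have Fp: "F p \<in> W" for p
    using sum.Lip0_closed [OF F] by (simp add: sum_space_simps(1))
  have "vnorm sum_space (F p \<ominus>\<^bsub>sum_space\<^esub> F q) \<le> c * dist p q" for p q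
  proof (rule vnorm_sum_space_le)
    fix i assume i: "i \<in> I"
    have "vnorm (Y i) (F p i \<ominus>\<^bsub>Y i\<^esub> F q i) \<le> vnorm (Lip0 z (Y i)) (\<lambda>p. F p i) * dist p q"
      by (rule lipschitz_maps.vnorm_diff_le_Lip0
        [OF lipschitz_maps_Y [OF i] Lip0_coordinate(1) [OF F i]])
    also have "\<dots> \<le> c * dist p q"
      by (intro mult_right_mono le i) simp
    finally show "vnorm (Y i) ((F p \<ominus>\<^bsub>sum_space\<^esub> F q) i) \<le> c * dist p q"
      using i by (simp add: sum_space_a_minus Fp)
  qed
  then have "vnorm (Lip0 z sum_space) F \<le> c"
    using c by (intro sum.vnorm_Lip0_le)
  with c show False
    by simp
qed

section \<open>Density for a coordinate sum\<close>

lemma closure_LipSNA_sum_space: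
  assumes dense: "\<And>i. i \<in> I \<Longrightarrow>
    mtopology_of (norm_metric (Lip0 z (Y i))) closure_of LipSNA z (Y i) = carrier (Lip0 z (Y i))"
  shows "mtopology_of (norm_metric (Lip0 z sum_space)) closure_of LipSNA z sum_space =
    carrier (Lip0 z sum_space)"
  unfolding sum.closure_LipSNA_iff
proof (intro ballI allI impI)
  fix F and e :: real assume F: "F \<in> carrier (Lip0 z sum_space)" and e: "0 < e"
  interpret LZ: real_normed_space "Lip0 z sum_space"
    by (rule sum.real_normed_space_Lip0)
  have near: "\<exists>H\<in>LipSNA z (Y i). vnorm (Lip0 z (Y i)) (F \<ominus>\<^bsub>Lip0 z (Y i)\<^esub> H) < r"
    if "i \<in> I" "F \<in> carrier (Lip0 z (Y i))" "0 < r" for i F r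
    using dense [OF that(1)] that
    unfolding lipschitz_maps.closure_LipSNA_iff [OF lipschitz_maps_Y [OF that(1)]] by blast
  let ?L = "vnorm (Lip0 z sum_space) F"
  show "\<exists>G\<in>LipSNA z sum_space. vnorm (Lip0 z sum_space) (F \<ominus>\<^bsub>Lip0 z sum_space\<^esub> G) < e"
  proof (cases "?L = 0")
    case True
    obtain i where i: "i \<in> I"
      using nonempty by blast
    have "LipSNA z (Y i) \<noteq> {}"
      using near [OF i Lip0_coordinate(1) [OF F i] zero_less_one] by blast
    then obtain p q :: 'm where pq: "p \<noteq> q"
      by (auto simp: LipSNA_def)
    \<comment> \<open>All slopes of \<open>F\<close> vanish, so any pair of distinct points attains
      the norm 0.\<close>
    have "vnorm sum_space (F p \<ominus>\<^bsub>sum_space\<^esub> F q) = 0"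
      using sum.vnorm_diff_le_Lip0 [OF F, of p q] True
        sum.vnorm_nonneg [of "F p \<ominus>\<^bsub>sum_space\<^esub> F q"] sum.Lip0_closed [OF F] by simp
    with pq F True have "F \<in> LipSNA z sum_space"
      by (auto simp: LipSNA_def)
    then show ?thesis
      using F e by (intro bexI) (simp_all add: LZ.a_minus_self LZ.vnorm_zero)
  next
    case False
    then have L: "0 < ?L"
      using sum.vnorm_Lip0_nonneg [OF F] by simp
    \<comment> \<open>The total error below is less than \<open>3 * r\<close>, hence less than
      \<open>e\<close>. The bound \<open>?L / 2\<close> keeps \<open>?L - 2 * r\<close> nonnegative,
      so that \<open>H\<close> has positive norm and can be rescaled.\<close>
    define r where "r = min (e / 4) (?L / 2)"
    have r: "0 < r" "r \<le> e / 4" "r \<le> ?L / 2"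
      using L e by (auto simp: r_def)
    obtain i where i: "i \<in> I" and Fi: "?L - r < vnorm (Lip0 z (Y i)) (\<lambda>p. F p i)"
      using ex_coordinate_norm_gt [OF F, of "?L - r"] r L by auto
    interpret Yi: lipschitz_maps "Y i" z
      using i by (rule lipschitz_maps_Y)
    interpret LY: real_normed_space "Lip0 z (Y i)"
      by (rule Yi.real_normed_space_Lip0)
    note coord = Lip0_coordinate [OF F i]
    obtain H where H: "H \<in> LipSNA z (Y i)"
      and FH: "vnorm (Lip0 z (Y i)) ((\<lambda>p. F p i) \<ominus>\<^bsub>Lip0 z (Y i)\<^esub> H) < r"
      using near [OF i coord(1) r(1)] by blast
    have Hc: "H \<in> carrier (Lip0 z (Y i))"
      using H by (simp add: LipSNA_def)
    let ?h = "vnorm (Lip0 z (Y i)) H"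
    \<comment> \<open>The norm of coordinate \<open>i\<close> of \<open>F\<close> lies above
      \<open>?L - r\<close> and is at most \<open>?L\<close>; that of \<open>H\<close> differs from
      it by less than \<open>r\<close>.\<close>
    have h: "?L - 2 * r < ?h" "?h < ?L + r"
      using LY.vnorm_le_a_minus [OF coord(1) Hc] LY.vnorm_le_a_minus [OF Hc coord(1)]
        LY.vnorm_a_minus_commute [OF coord(1) Hc] Fi FH coord(2) by linarith+
    then have h0: "0 < ?h"
      using r by linarith
    define c where "c = ?L / ?h"
    have c: "0 < c" "c * ?h = ?L"
      using h0 L by (simp_all add: c_def)
    define H' where "H' = c \<odot>\<^bsub>Lip0 z (Y i)\<^esub> H"
    have H'c: "H' \<in> carrier (Lip0 z (Y i))"
      unfolding H'_def using Hc by simp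
    have normH': "vnorm (Lip0 z (Y i)) H' = ?L"
      unfolding H'_def using Hc c by (simp add: LY.vnorm_smult)
    \<comment> \<open>The rescaled map is a multiple of \<open>H\<close>, so its distance from
      \<open>H\<close> is just the difference of the norms \<open>?h\<close> and
      \<open>?L\<close>.\<close>
    have "H \<ominus>\<^bsub>Lip0 z (Y i)\<^esub> H' = (1 - c) \<odot>\<^bsub>Lip0 z (Y i)\<^esub> H"
      using Hc LY.smult_l_distr [of 1 "- c" H] LY.smult_assoc1 [of "-1" c H] LY.smult_one [OF Hc]
      by (simp add: H'_def LY.a_minus_eq_smult)
    then have "vnorm (Lip0 z (Y i)) (H \<ominus>\<^bsub>Lip0 z (Y i)\<^esub> H') = \<bar>1 - c\<bar> * \<bar>?h\<bar>"
      using Hc h0 by (simp add: LY.vnorm_smult)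
    also have "\<dots> = \<bar>?h - ?L\<bar>"
      using c by (simp add: left_diff_distrib flip: abs_mult)
    also have "\<dots> < 2 * r"
      using h r by linarith
    finally have FH': "vnorm (Lip0 z (Y i)) ((\<lambda>p. F p i) \<ominus>\<^bsub>Lip0 z (Y i)\<^esub> H') < e"
      using LY.vnorm_a_minus_triangle [OF coord(1) Hc H'c] FH r by linarith
    define G where "G = (\<lambda>p. (F p)(i := H' p))"
    note G = Lip0_fun_upd [OF F i H'c, folded G_def]
    \<comment> \<open>Both terms of the maximum equal \<open>?L\<close>; this is what the exact
      rescaling achieves.\<close>
    have GL: "vnorm (Lip0 z sum_space) G \<le> ?L"
      using G(2) normH' by simp
    have Gp: "G p \<in> W" for p
      using sum.Lip0_closed [OF G(1)] by (simp add: sum_space_simps(1))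
    obtain p q where pq: "p \<noteq> q" and attained: "vnorm (Y i) (H p \<ominus>\<^bsub>Y i\<^esub> H q) / dist p q = ?h"
      using H by (auto simp: LipSNA_def)
    \<comment> \<open>Rescaling by \<open>c > 0\<close> multiplies all slopes and the norm alike, so
      the rescaled map attains its norm at the same pair.\<close>
    have "vnorm (Y i) (H' p \<ominus>\<^bsub>Y i\<^esub> H' q) = c * vnorm (Y i) (H p \<ominus>\<^bsub>Y i\<^esub> H q)"
      using c Yi.Lip0_closed [OF Hc]
      by (simp add: H'_def Yi.Lip0_simps Yi.vnorm_smult flip: Yi.smult_a_minus)
    also have "\<dots> = ?L * dist p q"
      using attained pq c by (simp add: field_simps)
    finally have "?L * dist p q = vnorm (Y i) (H' p \<ominus>\<^bsub>Y i\<^esub> H' q)" ..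
    also have "vnorm (Y i) (H' p \<ominus>\<^bsub>Y i\<^esub> H' q) = vnorm (Y i) ((G p \<ominus>\<^bsub>sum_space\<^esub> G q) i)"
      using i by (simp add: sum_space_a_minus Gp) (simp add: G_def)
    also have "\<dots> \<le> vnorm sum_space (G p \<ominus>\<^bsub>sum_space\<^esub> G q)"
      using i sum.M.minus_closed Gp
      by (intro vnorm_coordinate_le) (simp_all add: sum_space_simps(1))
    finally have ge: "?L * dist p q \<le> vnorm sum_space (G p \<ominus>\<^bsub>sum_space\<^esub> G q)" .
    have le: "vnorm sum_space (G p \<ominus>\<^bsub>sum_space\<^esub> G q) \<le> vnorm (Lip0 z sum_space) G * dist p q"
      by (rule sum.vnorm_diff_le_Lip0 [OF G(1)])
    \<comment> \<open>This closes the circle of inequalities from \<open>?L * dist p q\<close> back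
      to itself, so equality holds throughout.\<close>
    have "vnorm (Lip0 z sum_space) G * dist p q \<le> ?L * dist p q"
      using GL by (simp add: mult_right_mono)
    with ge le have "vnorm sum_space (G p \<ominus>\<^bsub>sum_space\<^esub> G q) = vnorm (Lip0 z sum_space) G * dist p q"
      by linarith
    then have "vnorm sum_space (G p \<ominus>\<^bsub>sum_space\<^esub> G q) / dist p q = vnorm (Lip0 z sum_space) G"
      using pq by simp
    with G(1) pq have "G \<in> LipSNA z sum_space"
      by (auto simp: LipSNA_def)
    then show ?thesis
      using G(3) FH' by (meson order_le_less_trans)
  qed
qed

end

end

theorem proposition4p10:
  fixes z :: "'m::complete_space"
    and I :: "'i set"
    and Y :: "'i \<Rightarrow> 'b normed"
    and Z :: "('i \<Rightarrow> 'b) normed"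
  assumes "I \<noteq> {}"
    and "\<And>i. i \<in> I \<Longrightarrow> real_banach_space (Y i)"
    and "Z = c0_sum I Y \<or> Z = linf_sum I Y"
    and "\<And>i. i \<in> I \<Longrightarrow>
      mtopology_of (norm_metric (Lip0 z (Y i))) closure_of LipSNA z (Y i) = carrier (Lip0 z (Y i))"
  shows "mtopology_of (norm_metric (Lip0 z Z)) closure_of LipSNA z Z = carrier (Lip0 z Z)"
proof -
  have normed: "real_normed_space (Y i)" if "i \<in> I" for i
    using assms(2) [OF that] by (rule real_banach_space.axioms(1))
  interpret coordinate_sum I Y "carrier Z"
    using assms(3) coordinate_sum_c0 [of I Y, OF assms(1) normed]
      coordinate_sum_linf [of I Y, OF assms(1) normed]
    by auto
  have "sum_space = Z"
    using assms(3) by (auto simp: sum_space_def c0_sum_def linf_sum_def)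
  then show ?thesis
    using closure_LipSNA_sum_space [OF assms(4)] by simp
qed

end
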